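(* Let $\mathcal C$ be the category of all algebras with one product satisfying a given finite collection of multilinear relations $\mathcal R_1=0,\dots,\mathcal R_k=0$. Let $(A,\mu)$ be an algebra belonging to $\mathcal C$, with product written $ab=\mu(a\otimes b)$, and let $\mathfrak R:A\to A$ be a Rota-Baxter operator (of weight zero) on $(A,\mu)$. For $a,b\in A$, let $a\succ b:=\mathfrak R(a)b$ and $a\prec b:=a\mathfrak R(b)$. Then $(A,\prec,\succ)$ is a $\mathcal C$-dendriform algebra.
   Context: All structures are over a commutative ring $R$ in which $2$ is invertible. An algebra $(A,\mu_1,\dots,\mu_m)$ is an $R$-module $A$ with linear maps $\mu_i:A\otimes A\to A$ (products); no associativity, unit or other property is assumed. A relation $\mathcal R=0$ (for algebras with one product) is given by an element $\mathcal R(x_1,\dots,x_n)$ of the free nonassociative $R$-algebra on variables $x_1,\dots,x_n$; an algebra satisfies it if $\mathcal R(a_1,\dots,a_n)=0$ for all $a_1,\dots,a_n\in A$. It is multilinear ($n$-linear) if $\mathcal R$ is an $R$-linear combination of parenthesized monomials each containing every one of $x_1,\dots,x_n$ exactly once. $\mathcal C$ has as objects all algebras $(A,\mu)$ satisfying $\mathcal R_1=0,\dots,\mathcal R_k=0$, and as morphisms the algebra homomorphisms. An algebra $(A,\prec,\succ)$ is a $\mathcal C$-dendriform algebra if $(A\times A,\boxtimes)\in\mathcal C$, where for $(a,x),(b,y)\in A\times A$, $$(a,x)\boxtimes(b,y):=(a\prec b+a\succ b,\ a\succ y+x\prec b).$$ A Rota-Baxter operator (of weight zero) on $(A,\mu)$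 is a linear map $\mathfrak R:A\to A$ such that $\mathfrak R(a\mathfrak R(b)+\mathfrak R(a)b)=\mathfrak R(a)\mathfrak R(b)$ for all $a,b\in A$. *)

theory Defs
  imports "HOL-Algebra.Module"
begin

text \<open>
  Parenthesized monomials, i.e. the nonempty words of the free magma, in the variables
  \<open>x\<^sub>1, x\<^sub>2, \<dots>\<close>; \<open>Var i\<close> stands for \<open>x\<^sub>i\<close>.
\<close>

datatype monomial = Var nat | Prod monomial monomial

primrec leaves :: "monomial \<Rightarrow> nat list" where
  "leaves (Var i) = [i]"
| "leaves (Prod s t) = leaves s @ leaves t"

definition monomials_of ::
  "('r, 'm) ring_scheme \<Rightarrow> (monomial \<Rightarrow> 'r) \<Rightarrow> monomial set" where
  "monomials_of R f = {t. f t \<noteq> \<zero>\<^bsub>R\<^esub>}"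

text \<open>
  The elements of the free nonassociative \<open>R\<close>-algebra on \<open>x\<^sub>1, \<dots>, x\<^sub>n\<close>: it is the free
  \<open>R\<close>-module on the monomials in these variables, so an element is a finitely supported
  coefficient function. Its multiplication (the bilinear extension of \<open>Prod\<close>) is not needed
  below, since elements are only evaluated.
\<close>

definition free_nonassoc_algebra ::
  "('r, 'm) ring_scheme \<Rightarrow> nat \<Rightarrow> (monomial \<Rightarrow> 'r) set" where
  "free_nonassoc_algebra R n =
     {f. (\<forall>t. f t \<in> carrier R) \<and> finite (monomials_of R f) \<and>
         (\<forall>t \<in> monomials_of R f. set (leaves t) \<subseteq> {1..n})}"

definition multilinear :: "('r, 'm) ring_scheme \<Rightarrow> nat \<Rightarrow> (monomial \<Rightarrow> 'r) \<Rightarrow> bool" where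
  "multilinear R n f \<longleftrightarrow>
     f \<in> free_nonassoc_algebra R n \<and>
     (\<forall>t \<in> monomials_of R f. \<forall>i \<in> {1..n}. count_list (leaves t) i = 1)"

definition linear_map ::
  "('r, 'm) ring_scheme \<Rightarrow> ('r, 'a, 'n) module_scheme \<Rightarrow> ('r, 'b, 'k) module_scheme \<Rightarrow>
   ('a \<Rightarrow> 'b) \<Rightarrow> bool" where
  "linear_map R M N f \<longleftrightarrow>
     f \<in> carrier M \<rightarrow> carrier N \<and>
     (\<forall>x \<in> carrier M. \<forall>y \<in> carrier M. f (x \<oplus>\<^bsub>M\<^esub> y) = f x \<oplus>\<^bsub>N\<^esub> f y) \<and>
     (\<forall>r \<in> carrier R. \<forall>x \<in> carrier M. f (r \<odot>\<^bsub>M\<^esub> x) = r \<odot>\<^bsub>N\<^esub> f x)"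

text \<open>
  A linear map \<open>M \<otimes> M \<rightarrow> M\<close>, given as the corresponding bilinear map. The field
  \<^const>\<open>mult\<close> of the module record plays no role.
\<close>

definition product_on ::
  "('r, 'm) ring_scheme \<Rightarrow> ('r, 'a, 'n) module_scheme \<Rightarrow> ('a \<Rightarrow> 'a \<Rightarrow> 'a) \<Rightarrow> bool" where
  "product_on R M \<mu> \<longleftrightarrow>
     (\<forall>x \<in> carrier M. linear_map R M M (\<lambda>y. \<mu> x y)) \<and>
     (\<forall>y \<in> carrier M. linear_map R M M (\<lambda>x. \<mu> x y))"

primrec eval_monomial :: "('a \<Rightarrow> 'a \<Rightarrow> 'a) \<Rightarrow> (nat \<Rightarrow> 'a) \<Rightarrow> monomial \<Rightarrow> 'a" where
  "eval_monomial \<mu> a (Var i) = a i"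
| "eval_monomial \<mu> a (Prod s t) = \<mu> (eval_monomial \<mu> a s) (eval_monomial \<mu> a t)"

definition eval_relation ::
  "('r, 'm) ring_scheme \<Rightarrow> ('r, 'a, 'n) module_scheme \<Rightarrow> ('a \<Rightarrow> 'a \<Rightarrow> 'a) \<Rightarrow>
   (monomial \<Rightarrow> 'r) \<Rightarrow> (nat \<Rightarrow> 'a) \<Rightarrow> 'a" where
  "eval_relation R M \<mu> f a =
     (\<Oplus>\<^bsub>M\<^esub> t \<in> monomials_of R f. f t \<odot>\<^bsub>M\<^esub> eval_monomial \<mu> a t)"

definition satisfies ::
  "('r, 'm) ring_scheme \<Rightarrow> ('r, 'a, 'n) module_scheme \<Rightarrow> ('a \<Rightarrow> 'a \<Rightarrow> 'a) \<Rightarrow>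
   nat \<Rightarrow> (monomial \<Rightarrow> 'r) \<Rightarrow> bool" where
  "satisfies R M \<mu> n f \<longleftrightarrow>
     (\<forall>a. (\<forall>i \<in> {1..n}. a i \<in> carrier M) \<longrightarrow> eval_relation R M \<mu> f a = \<zero>\<^bsub>M\<^esub>)"

text \<open>
  \<open>(M, \<mu>)\<close> is an object of the category of algebras defined by the relations listed in \<open>Rels\<close>;
  each relation is given together with its number of variables.
\<close>

definition in_category ::
  "('r, 'm) ring_scheme \<Rightarrow> (nat \<times> (monomial \<Rightarrow> 'r)) list \<Rightarrow>
   ('r, 'a, 'n) module_scheme \<Rightarrow> ('a \<Rightarrow> 'a \<Rightarrow> 'a) \<Rightarrow> bool" where
  "in_category R Rels M \<mu> \<longleftrightarrow>
     module R M \<and> product_on R M \<mu> \<and> (\<forall>(n, f) \<in> set Rels. satisfies R M \<mu> n f)"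

text \<open>
  The product module. The ring fields \<^const>\<open>mult\<close> and \<^const>\<open>one\<close> are irrelevant for a
  module and are filled in componentwise.
\<close>

definition prod_module ::
  "('r, 'a, 'n) module_scheme \<Rightarrow> ('r, 'b, 'k) module_scheme \<Rightarrow> ('r, 'a \<times> 'b) module" where
  "prod_module M N =
     \<lparr>carrier = carrier M \<times> carrier N,
      monoid.mult = (\<lambda>(a, x) (b, y). (a \<otimes>\<^bsub>M\<^esub> b, x \<otimes>\<^bsub>N\<^esub> y)),
      one = (\<one>\<^bsub>M\<^esub>, \<one>\<^bsub>N\<^esub>),
      zero = (\<zero>\<^bsub>M\<^esub>, \<zero>\<^bsub>N\<^esub>),
      add = (\<lambda>(a, x) (b, y). (a \<oplus>\<^bsub>M\<^esub> b, x \<oplus>\<^bsub>N\<^esub> y)),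
      smult = (\<lambda>r (a, x). (r \<odot>\<^bsub>M\<^esub> a, r \<odot>\<^bsub>N\<^esub> x))\<rparr>"

fun boxtimes ::
  "('r, 'a, 'n) module_scheme \<Rightarrow> ('a \<Rightarrow> 'a \<Rightarrow> 'a) \<Rightarrow> ('a \<Rightarrow> 'a \<Rightarrow> 'a) \<Rightarrow>
   'a \<times> 'a \<Rightarrow> 'a \<times> 'a \<Rightarrow> 'a \<times> 'a" where
  "boxtimes M prec succ (a, x) (b, y) =
     (prec a b \<oplus>\<^bsub>M\<^esub> succ a b, succ a y \<oplus>\<^bsub>M\<^esub> prec x b)"

definition dendriform_algebra ::
  "('r, 'm) ring_scheme \<Rightarrow> (nat \<times> (monomial \<Rightarrow> 'r)) list \<Rightarrow>
   ('r, 'a, 'n) module_scheme \<Rightarrow> ('a \<Rightarrow> 'a \<Rightarrow> 'a) \<Rightarrow> ('a \<Rightarrow> 'a \<Rightarrow> 'a) \<Rightarrow> bool" where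
  "dendriform_algebra R Rels M prec succ \<longleftrightarrow>
     module R M \<and> product_on R M prec \<and> product_on R M succ \<and>
     in_category R Rels (prod_module M M) (boxtimes M prec succ)"

definition rota_baxter_operator ::
  "('r, 'm) ring_scheme \<Rightarrow> ('r, 'a, 'n) module_scheme \<Rightarrow> ('a \<Rightarrow> 'a \<Rightarrow> 'a) \<Rightarrow>
   ('a \<Rightarrow> 'a) \<Rightarrow> bool" where
  "rota_baxter_operator R M \<mu> P \<longleftrightarrow>
     linear_map R M M P \<and>
     (\<forall>a \<in> carrier M. \<forall>b \<in> carrier M. P (\<mu> a (P b) \<oplus>\<^bsub>M\<^esub> \<mu> (P a) b) = \<mu> (P a) (P b))"

end

theory Submission
  imports Defs
begin

text \<open>
  In the product \<open>\<boxtimes>\<close> built from \<open>a \<prec> b = a P(b)\<close> and \<open>a \<succ> b = P(a) b\<close>, the second component of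
  \<open>(a, x) \<boxtimes> (b, y)\<close> is \<open>P(a) y + x P(b)\<close>: it is the linear part at \<open>P(a), P(b)\<close> in the directions
  \<open>x, y\<close>. Since the Rota-Baxter identity says that \<open>P\<close> of the first component is again the product
  of the \<open>P(a), P(b)\<close>, a multilinear monomial evaluated at \<open>(a\<^sub>i, x\<^sub>i)\<close> has second component
  \<open>\<Sum>\<^sub>j t(P(a\<^sub>1), \<dots>, x\<^sub>j, \<dots>, P(a\<^sub>n))\<close>. A multilinear relation therefore evaluates to a sum of \<open>n\<close> of its
  values in \<open>A\<close>, all of which vanish. The first component is the second one for \<open>x\<^sub>i = a\<^sub>i\<close>.
\<close>

section \<open>Finite sums and linear maps\<close>

lemma (in abelian_monoid) finsum_swap:
  assumes "finite I"
    and "\<And>i j. i \<in> I \<Longrightarrow> j \<in> J \<Longrightarrow> h i j \<in> carrier G"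
  shows "(\<Oplus>i\<in>I. \<Oplus>j\<in>J. h i j) = (\<Oplus>j\<in>J. \<Oplus>i\<in>I. h i j)"
  using assms
proof (induction I rule: finite_induct)
  case empty
  then show ?case by simp
next
  case (insert i I)
  have "(\<Oplus>k\<in>insert i I. \<Oplus>j\<in>J. h k j) = (\<Oplus>j\<in>J. h i j) \<oplus> (\<Oplus>j\<in>J. \<Oplus>k\<in>I. h k j)"
    using insert by (subst finsum_insert) (auto intro!: finsum_closed)
  also have "\<dots> = (\<Oplus>j\<in>J. h i j \<oplus> (\<Oplus>k\<in>I. h k j))"
    using insert.prems by (intro finsum_addf [symmetric]) (auto intro!: finsum_closed)
  also have "\<dots> = (\<Oplus>j\<in>J. \<Oplus>k\<in>insert i I. h k j)"
    using insert by (intro finsum_cong') (auto intro!: finsum_closed)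
  finally show ?case .
qed

lemma linear_map_closed: "linear_map R M N f \<Longrightarrow> x \<in> carrier M \<Longrightarrow> f x \<in> carrier N"
  and linear_map_add: "linear_map R M N f \<Longrightarrow> x \<in> carrier M \<Longrightarrow> y \<in> carrier M \<Longrightarrow>
    f (x \<oplus>\<^bsub>M\<^esub> y) = f x \<oplus>\<^bsub>N\<^esub> f y"
  and linear_map_smult: "linear_map R M N f \<Longrightarrow> r \<in> carrier R \<Longrightarrow> x \<in> carrier M \<Longrightarrow>
    f (r \<odot>\<^bsub>M\<^esub> x) = r \<odot>\<^bsub>N\<^esub> f x"
  by (auto simp: linear_map_def)

lemma linear_map_zero:
  assumes "abelian_group M" and "abelian_group N" and f: "linear_map R M N f"
  shows "f \<zero>\<^bsub>M\<^esub> = \<zero>\<^bsub>N\<^esub>"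
proof -
  interpret M: abelian_group M by fact
  interpret N: abelian_group N by fact
  \<comment> \<open>The image of zero is idempotent for addition, so cancellation in
    \<open>N\<close> makes it zero.\<close>
  have "f \<zero>\<^bsub>M\<^esub> \<oplus>\<^bsub>N\<^esub> f \<zero>\<^bsub>M\<^esub> = f \<zero>\<^bsub>M\<^esub>"
    using linear_map_add [OF f, of "\<zero>\<^bsub>M\<^esub>" "\<zero>\<^bsub>M\<^esub>"] by simp
  then show ?thesis
    using linear_map_closed [OF f] N.add.l_cancel_one' by (metis M.zero_closed)
qed

lemma linear_map_finsum:
  assumes "abelian_group M" and "abelian_group N" and f: "linear_map R M N f"
    and g: "\<And>i. i \<in> I \<Longrightarrow> g i \<in> carrier M"
  shows "f (\<Oplus>\<^bsub>M\<^esub>i\<in>I. g i) = (\<Oplus>\<^bsub>N\<^esub>i\<in>I. f (g i))"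
proof -
  interpret M: abelian_group M by fact
  interpret N: abelian_group N by fact
  note zero = linear_map_zero [OF assms(1-3)]
  show ?thesis
    using g
  proof (induction I rule: infinite_finite_induct)
    case (insert i I)
    have "f (\<Oplus>\<^bsub>M\<^esub>k\<in>insert i I. g k) = f (g i) \<oplus>\<^bsub>N\<^esub> f (\<Oplus>\<^bsub>M\<^esub>k\<in>I. g k)"
      using insert by (simp add: Pi_def linear_map_add [OF f])
    with insert show ?case
      by (simp add: Pi_def linear_map_closed [OF f])
  \<comment> \<open>Over an infinite index set both sums are zero by convention, so this case, like
    the empty one, comes down to \<open>f\<close> preserving zero.\<close>
  qed (simp_all add: zero)
qed

section \<open>The product module and its projections\<close>

lemma prod_module_simps [simp]:
  "carrier (prod_module M N) = carrier M \<times> carrier N"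
  "\<zero>\<^bsub>prod_module M N\<^esub> = (\<zero>\<^bsub>M\<^esub>, \<zero>\<^bsub>N\<^esub>)"
  "p \<oplus>\<^bsub>prod_module M N\<^esub> q = (fst p \<oplus>\<^bsub>M\<^esub> fst q, snd p \<oplus>\<^bsub>N\<^esub> snd q)"
  "r \<odot>\<^bsub>prod_module M N\<^esub> p = (r \<odot>\<^bsub>M\<^esub> fst p, r \<odot>\<^bsub>N\<^esub> snd p)"
  by (simp_all add: prod_module_def case_prod_beta)

lemma module_prod_module:
  assumes "module R M" and "module R N"
  shows "module R (prod_module M N)"
proof -
  interpret M: module R M by fact
  interpret N: module R N by fact
  show ?thesis
  proof (rule moduleI)
    show "abelian_group (prod_module M N)"
    proof (rule abelian_groupI)
      fix x assume "x \<in> carrier (prod_module M N)"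
      then show "\<exists>y\<in>carrier (prod_module M N). y \<oplus>\<^bsub>prod_module M N\<^esub> x = \<zero>\<^bsub>prod_module M N\<^esub>"
        by (intro bexI [of _ "(\<ominus>\<^bsub>M\<^esub> fst x, \<ominus>\<^bsub>N\<^esub> snd x)"]) (auto simp: M.l_neg N.l_neg)
    qed (auto simp: M.a_ac N.a_ac)
  qed (auto simp: M.R.is_cring M.smult_l_distr N.smult_l_distr M.smult_r_distr N.smult_r_distr
      M.smult_assoc1 N.smult_assoc1)
qed

lemma linear_map_fst: "linear_map R (prod_module M N) M fst"
  and linear_map_snd: "linear_map R (prod_module M N) N snd"
  by (auto simp: linear_map_def)

section \<open>Evaluation of monomials, and the leaves of a multilinear relation\<close>

lemma eval_monomial_cong:
  assumes "\<And>i. i \<in> set (leaves t) \<Longrightarrow> v i = w i"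
  shows "eval_monomial \<mu> v t = eval_monomial \<mu> w t"
  using assms by (induction t) auto

lemma eval_monomial_closed:
  assumes "product_on R M \<mu>" and "\<And>i. i \<in> set (leaves t) \<Longrightarrow> v i \<in> carrier M"
  shows "eval_monomial \<mu> v t \<in> carrier M"
  using assms(2)
proof (induction t)
  case (Prod s t)
  then have "eval_monomial \<mu> v s \<in> carrier M" and "eval_monomial \<mu> v t \<in> carrier M"
    by simp_all
  then show ?case
    using assms(1) by (auto simp: product_on_def linear_map_def)
qed simp

lemma multilinearD:
  assumes "multilinear R n f" and "t \<in> monomials_of R f"
  shows "set (leaves t) = {1..n}" and "distinct (leaves t)"
proof -
  have sub: "set (leaves t) \<subseteq> {1..n}" and one: "\<And>i. i \<in> {1..n} \<Longrightarrow> count_list (leaves t) i = 1"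
    using assms by (auto simp: multilinear_def free_nonassoc_algebra_def)
  have "i \<in> set (leaves t)" if "i \<in> {1..n}" for i
    using one [OF that] count_notin by fastforce
  with sub show eq: "set (leaves t) = {1..n}"
    by blast
  \<comment> \<open>The counts of the variables add up to the length of the list. Each count is one,
    so the length equals the number of different leaves, which forces distinctness.\<close>
  have "length (leaves t) = sum (count_list (leaves t)) {1..n}"
    using sum_count_set [OF sub] by simp
  also have "\<dots> = card (set (leaves t))"
    using one by (simp add: eq)
  finally show "distinct (leaves t)"
    by (simp add: card_distinct)
qed

section \<open>The product on pairs given by a Rota-Baxter operator\<close>

locale rota_baxter_algebra = module R A
  for R :: "('r, 'm) ring_scheme" and A :: "('r, 'a, 'n) module_scheme" +
  fixes \<mu> :: "'a \<Rightarrow> 'a \<Rightarrow> 'a" and P :: "'a \<Rightarrow> 'a"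
  assumes product: "product_on R A \<mu>"
    and rota_baxter: "rota_baxter_operator R A \<mu> P"
begin

definition box :: "'a \<times> 'a \<Rightarrow> 'a \<times> 'a \<Rightarrow> 'a \<times> 'a" where
  "box = boxtimes A (\<lambda>a b. \<mu> a (P b)) (\<lambda>a b. \<mu> (P a) b)"

text \<open>\<open>boxtimes\<close> unfolds only on explicit pairs; stating its components through
  projections makes them available for evaluated monomials.\<close>

lemma box_simps:
  "fst (box p q) = \<mu> (fst p) (P (fst q)) \<oplus>\<^bsub>A\<^esub> \<mu> (P (fst p)) (fst q)"
  "snd (box p q) = \<mu> (P (fst p)) (snd q) \<oplus>\<^bsub>A\<^esub> \<mu> (snd p) (P (fst q))"
  by (cases p; cases q; simp add: box_def)+

lemma linear_P: "linear_map R A A P"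
  using rota_baxter by (simp add: rota_baxter_operator_def)

lemma linear_left: "y \<in> carrier A \<Longrightarrow> linear_map R A A (\<lambda>x. \<mu> x y)"
  and linear_right: "x \<in> carrier A \<Longrightarrow> linear_map R A A (\<mu> x)"
  using product by (auto simp: product_on_def)

lemma P_closed [simp]: "x \<in> carrier A \<Longrightarrow> P x \<in> carrier A"
  by (rule linear_map_closed [OF linear_P])

lemma \<mu>_closed [simp]: "x \<in> carrier A \<Longrightarrow> y \<in> carrier A \<Longrightarrow> \<mu> x y \<in> carrier A"
  by (rule linear_map_closed [OF linear_right])

lemmas P_linear_simps = linear_map_add [OF linear_P] linear_map_smult [OF linear_P]

lemmas \<mu>_linear_simps =
  linear_map_add [OF linear_left] linear_map_smult [OF linear_left]
  linear_map_add [OF linear_right] linear_map_smult [OF linear_right]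

lemma product_prec: "product_on R A (\<lambda>a b. \<mu> a (P b))"
  and product_succ: "product_on R A (\<lambda>a b. \<mu> (P a) b)"
  by (auto simp: product_on_def linear_map_def P_linear_simps \<mu>_linear_simps)

lemma product_box: "product_on R (prod_module A A) box"
  by (auto simp: product_on_def linear_map_def box_simps prod_eq_iff mem_Times_iff P_linear_simps
      \<mu>_linear_simps smult_r_distr M.a_ac)

text \<open>The Rota-Baxter identity says exactly that \<open>P\<close> after \<open>fst\<close>
  carries \<open>box\<close> to \<open>\<mu>\<close>; such a homomorphism commutes with the
  evaluation of any monomial.\<close>

lemma P_fst_eval_box:
  assumes "\<And>i. i \<in> set (leaves t) \<Longrightarrow> v i \<in> carrier A \<times> carrier A"
  shows "P (fst (eval_monomial box v t)) = eval_monomial \<mu> (\<lambda>i. P (fst (v i))) t"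
  using assms
proof (induction t)
  case (Prod s t)
  let ?s = "eval_monomial box v s" and ?t = "eval_monomial box v t"
  have "?s \<in> carrier A \<times> carrier A" "?t \<in> carrier A \<times> carrier A"
    using eval_monomial_closed [OF product_box] Prod.prems by auto
  then have "P (fst (box ?s ?t)) = \<mu> (P (fst ?s)) (P (fst ?t))"
    using rota_baxter by (simp add: box_simps rota_baxter_operator_def mem_Times_iff)
  with Prod show ?case
    by simp
qed simp

text \<open>This is a Leibniz rule: in \<open>snd (box p q)\<close> one factor contributes its
  second component while the other is held at its value under \<open>P\<close>. Since the leaves are
  distinct, the sum over the variables of a product splits into disjoint sums over those of its two
  factors.\<close>

lemma snd_eval_box:
  assumes "distinct (leaves t)"
    and "\<And>i. i \<in> set (leaves t) \<Longrightarrow> v i \<in> carrier A \<times> carrier A"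
  shows "snd (eval_monomial box v t) =
    (\<Oplus>\<^bsub>A\<^esub>i\<in>set (leaves t). eval_monomial \<mu> ((\<lambda>k. P (fst (v k)))(i := snd (v i))) t)"
  using assms
proof (induction t)
  case (Var i)
  then show ?case by (simp add: mem_Times_iff)
next
  case (Prod s t)
  let ?p = "\<lambda>k. P (fst (v k))"
  let ?e = "\<lambda>i. eval_monomial \<mu> (?p(i := snd (v i)))"
  have v: "fst (v i) \<in> carrier A" "snd (v i) \<in> carrier A"
    if "i \<in> set (leaves s) \<union> set (leaves t)" for i
    using Prod.prems(2) that by (auto simp: mem_Times_iff)
  have disj: "set (leaves s) \<inter> set (leaves t) = {}"
    using Prod.prems(1) by simp
  have ps: "eval_monomial \<mu> ?p s \<in> carrier A" and pt: "eval_monomial \<mu> ?p t \<in> carrier A"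
    by (auto intro!: eval_monomial_closed [OF product] simp: v)
  have es: "?e i s \<in> carrier A" if "i \<in> set (leaves s)" for i
    using that by (auto intro!: eval_monomial_closed [OF product] simp: v)
  have et: "?e i t \<in> carrier A" if "i \<in> set (leaves t)" for i
    using that by (auto intro!: eval_monomial_closed [OF product] simp: v)
  \<comment> \<open>A variable of one factor does not occur in the other, so changing its value
    leaves the other factor as it was.\<close>
  have es': "?e i s = eval_monomial \<mu> ?p s" if "i \<in> set (leaves t)" for i
    using that disj by (intro eval_monomial_cong) auto
  have et': "?e i t = eval_monomial \<mu> ?p t" if "i \<in> set (leaves s)" for i
    using that disj by (intro eval_monomial_cong) auto
  \<comment> \<open>The first components under \<open>P\<close> come from
    \<open>P_fst_eval_box\<close>, the second ones from the induction hypotheses. Removing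
    \<open>fun_upd_apply\<close> keeps the updated valuations in the form used by
    \<open>?e\<close>.\<close>
  have "snd (eval_monomial box v (Prod s t)) =
      \<mu> (eval_monomial \<mu> ?p s) (\<Oplus>\<^bsub>A\<^esub>i\<in>set (leaves t). ?e i t) \<oplus>\<^bsub>A\<^esub>
      \<mu> (\<Oplus>\<^bsub>A\<^esub>i\<in>set (leaves s). ?e i s) (eval_monomial \<mu> ?p t)"
    using Prod by (simp add: box_simps P_fst_eval_box del: fun_upd_apply)
  also have "\<mu> (eval_monomial \<mu> ?p s) (\<Oplus>\<^bsub>A\<^esub>i\<in>set (leaves t). ?e i t) =
      (\<Oplus>\<^bsub>A\<^esub>i\<in>set (leaves t). \<mu> (eval_monomial \<mu> ?p s) (?e i t))"
    by (rule linear_map_finsum [OF M.abelian_group_axioms M.abelian_group_axioms linear_right])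
      (auto simp: ps et)
  also have "\<dots> = (\<Oplus>\<^bsub>A\<^esub>i\<in>set (leaves t). ?e i (Prod s t))"
    by (rule M.finsum_cong') (auto simp: ps es' et)
  also have "\<mu> (\<Oplus>\<^bsub>A\<^esub>i\<in>set (leaves s). ?e i s) (eval_monomial \<mu> ?p t) =
      (\<Oplus>\<^bsub>A\<^esub>i\<in>set (leaves s). \<mu> (?e i s) (eval_monomial \<mu> ?p t))"
    by (rule linear_map_finsum [OF M.abelian_group_axioms M.abelian_group_axioms linear_left])
      (auto simp: pt es)
  also have "\<dots> = (\<Oplus>\<^bsub>A\<^esub>i\<in>set (leaves s). ?e i (Prod s t))"
    by (rule M.finsum_cong') (auto simp: pt et' es)
  also have "(\<Oplus>\<^bsub>A\<^esub>i\<in>set (leaves t). ?e i (Prod s t)) \<oplus>\<^bsub>A\<^esub>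
      (\<Oplus>\<^bsub>A\<^esub>i\<in>set (leaves s). ?e i (Prod s t)) =
      (\<Oplus>\<^bsub>A\<^esub>i\<in>set (leaves t) \<union> set (leaves s). ?e i (Prod s t))"
    using disj by (intro M.finsum_Un_disjoint [symmetric]) (auto simp: ps pt es et es' et')
  finally show ?case
    by (simp add: Un_commute del: fun_upd_apply)
qed

text \<open>On diagonal pairs the two components of \<open>box\<close> differ only in the order of
  the summands. This reduces first components to second components, so that the Leibniz rule serves
  for both.\<close>

lemma fst_eval_box:
  assumes "\<And>i. i \<in> set (leaves t) \<Longrightarrow> v i \<in> carrier A \<times> carrier A"
  shows "fst (eval_monomial box v t) = snd (eval_monomial box (\<lambda>i. (fst (v i), fst (v i))) t)"
  using assms
proof (induction t)
  case (Prod s t)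
  let ?w = "\<lambda>i. (fst (v i), fst (v i))"
  have closed: "eval_monomial box v s \<in> carrier A \<times> carrier A"
    "eval_monomial box v t \<in> carrier A \<times> carrier A"
    using eval_monomial_closed [OF product_box] Prod.prems by auto
  \<comment> \<open>By \<open>P_fst_eval_box\<close> each side is an evaluation in \<open>A\<close>
    that depends only on the first components of the valuation, and \<open>?w\<close> has the same
    ones as \<open>v\<close>.\<close>
  have "P (fst (eval_monomial box ?w s)) = P (fst (eval_monomial box v s))"
    "P (fst (eval_monomial box ?w t)) = P (fst (eval_monomial box v t))"
    using Prod.prems by (subst (1 2) P_fst_eval_box; force simp: mem_Times_iff)+
  moreover have "fst (eval_monomial box v s) = snd (eval_monomial box ?w s)"
    "fst (eval_monomial box v t) = snd (eval_monomial box ?w t)"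
    using Prod by auto
  ultimately show ?case
    using closed by (auto simp: box_simps mem_Times_iff intro!: M.a_comm)
qed simp

section \<open>Transfer of multilinear relations to the product on pairs\<close>

lemma snd_eval_relation_box:
  assumes f: "multilinear R n f" and sat: "satisfies R A \<mu> n f"
    and v: "\<And>i. i \<in> {1..n} \<Longrightarrow> v i \<in> carrier A \<times> carrier A"
  shows "(\<Oplus>\<^bsub>A\<^esub>t\<in>monomials_of R f. f t \<odot>\<^bsub>A\<^esub> snd (eval_monomial box v t)) = \<zero>\<^bsub>A\<^esub>"
proof -
  let ?w = "\<lambda>i. (\<lambda>k. P (fst (v k)))(i := snd (v i))"
  let ?T = "monomials_of R f"
  note leaves = multilinearD [OF f]
  have fin: "finite ?T" and coeff: "\<And>t. f t \<in> carrier R"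
    using f by (auto simp: multilinear_def free_nonassoc_algebra_def)
  have w: "?w i k \<in> carrier A" if "i \<in> {1..n}" "k \<in> {1..n}" for i k
    using v [OF that(1)] v [OF that(2)] by (auto simp: mem_Times_iff)
  have e: "eval_monomial \<mu> (?w i) t \<in> carrier A" if "t \<in> ?T" "i \<in> {1..n}" for i t
    using that w leaves(1) by (intro eval_monomial_closed [OF product]) blast
  \<comment> \<open>Compatibility with scalars rests on the commutativity of
    \<open>R\<close>.\<close>
  have smult: "linear_map R A A (\<lambda>x. f t \<odot>\<^bsub>A\<^esub> x)" for t
    using coeff by (auto simp: linear_map_def smult_r_distr smult_assoc1 [symmetric] R.m_comm)
  have "f t \<odot>\<^bsub>A\<^esub> snd (eval_monomial box v t) =
      (\<Oplus>\<^bsub>A\<^esub>i\<in>{1..n}. f t \<odot>\<^bsub>A\<^esub> eval_monomial \<mu> (?w i) t)" if t: "t \<in> ?T" for t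
  proof -
    \<comment> \<open>Every monomial of \<open>f\<close> has leaf set \<open>{1..n}\<close>, so the
      index set of the inner sum does not depend on \<open>t\<close>; this is what permits the
      exchange of the two sums below.\<close>
    have "snd (eval_monomial box v t) = (\<Oplus>\<^bsub>A\<^esub>i\<in>{1..n}. eval_monomial \<mu> (?w i) t)"
      using snd_eval_box [of t v] leaves [OF t] v by simp
    also have "f t \<odot>\<^bsub>A\<^esub> \<dots> = (\<Oplus>\<^bsub>A\<^esub>i\<in>{1..n}. f t \<odot>\<^bsub>A\<^esub> eval_monomial \<mu> (?w i) t)"
      using e [OF t]
      by (rule linear_map_finsum [OF M.abelian_group_axioms M.abelian_group_axioms smult])
    finally show ?thesis .
  qed
  then have "(\<Oplus>\<^bsub>A\<^esub>t\<in>?T. f t \<odot>\<^bsub>A\<^esub> snd (eval_monomial box v t)) =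
      (\<Oplus>\<^bsub>A\<^esub>t\<in>?T. \<Oplus>\<^bsub>A\<^esub>i\<in>{1..n}. f t \<odot>\<^bsub>A\<^esub> eval_monomial \<mu> (?w i) t)"
    by (intro M.finsum_cong') (auto intro!: M.finsum_closed smult_closed coeff e)
  also have "\<dots> = (\<Oplus>\<^bsub>A\<^esub>i\<in>{1..n}. \<Oplus>\<^bsub>A\<^esub>t\<in>?T. f t \<odot>\<^bsub>A\<^esub> eval_monomial \<mu> (?w i) t)"
    by (rule M.finsum_swap) (auto intro!: fin smult_closed coeff e)
  \<comment> \<open>For fixed \<open>i\<close> the inner sum is the value of the relation in
    \<open>A\<close> at the valuation \<open>?w i\<close>, hence zero by \<open>sat\<close>.\<close>
  also have "\<dots> = (\<Oplus>\<^bsub>A\<^esub>i\<in>{1..n}. \<zero>\<^bsub>A\<^esub>)"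
    using sat w by (intro M.finsum_cong') (auto simp: satisfies_def eval_relation_def)
  finally show ?thesis
    by simp
qed

text \<open>The projections are linear, so the relation can be checked in each component. The second
  vanishes by \<open>snd_eval_relation_box\<close> at \<open>v\<close>, the first by the same lemma
  at the diagonal valuation \<open>?w\<close>.\<close>

lemma satisfies_box:
  assumes f: "multilinear R n f" and sat: "satisfies R A \<mu> n f"
  shows "satisfies R (prod_module A A) box n f"
  unfolding satisfies_def
proof (intro allI impI)
  fix v :: "nat \<Rightarrow> 'a \<times> 'a"
  let ?AA = "prod_module A A" and ?T = "monomials_of R f"
  assume "\<forall>i\<in>{1..n}. v i \<in> carrier ?AA"
  then have v: "\<And>i. i \<in> {1..n} \<Longrightarrow> v i \<in> carrier A \<times> carrier A"
    by simp
  note leaves = multilinearD(1) [OF f]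
  have ag: "abelian_group ?AA"
    using module_prod_module [OF module_axioms module_axioms] by (simp add: module_def)
  have coeff: "\<And>t. f t \<in> carrier R"
    using f by (auto simp: multilinear_def free_nonassoc_algebra_def)
  have e: "eval_monomial box w t \<in> carrier A \<times> carrier A"
    if "t \<in> ?T" "\<And>i. i \<in> {1..n} \<Longrightarrow> w i \<in> carrier A \<times> carrier A" for t w
    using eval_monomial_closed [OF product_box, of t w] leaves that by auto
  have closed: "f t \<odot>\<^bsub>?AA\<^esub> eval_monomial box v t \<in> carrier ?AA" if "t \<in> ?T" for t
    using e [OF that v] coeff by (auto simp: mem_Times_iff)
  have snd: "snd (eval_relation R ?AA box f v) = \<zero>\<^bsub>A\<^esub>"
    unfolding eval_relation_def
    using snd_eval_relation_box [OF f sat v]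
    by (subst linear_map_finsum [OF ag M.abelian_group_axioms linear_map_snd]) (use closed in auto)
  let ?w = "\<lambda>i. (fst (v i), fst (v i))"
  have w: "\<And>i. i \<in> {1..n} \<Longrightarrow> ?w i \<in> carrier A \<times> carrier A"
    using v by (auto simp: mem_Times_iff)
  have "fst (eval_relation R ?AA box f v) =
      (\<Oplus>\<^bsub>A\<^esub>t\<in>?T. f t \<odot>\<^bsub>A\<^esub> fst (eval_monomial box v t))"
    unfolding eval_relation_def
    by (subst linear_map_finsum [OF ag M.abelian_group_axioms linear_map_fst]) (use closed in auto)
  also have "\<dots> = (\<Oplus>\<^bsub>A\<^esub>t\<in>?T. f t \<odot>\<^bsub>A\<^esub> snd (eval_monomial box ?w t))"
  proof (rule M.finsum_cong')
    show "(\<lambda>t. f t \<odot>\<^bsub>A\<^esub> snd (eval_monomial box ?w t)) \<in> ?T \<rightarrow> carrier A"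
      using e [OF _ w] coeff by (auto simp: mem_Times_iff)
    show "f t \<odot>\<^bsub>A\<^esub> fst (eval_monomial box v t) = f t \<odot>\<^bsub>A\<^esub> snd (eval_monomial box ?w t)"
      if "t \<in> ?T" for t
      using fst_eval_box [of t v] leaves [OF that] v by simp
  qed simp
  also have "\<dots> = \<zero>\<^bsub>A\<^esub>"
    using snd_eval_relation_box [OF f sat w] .
  finally show "eval_relation R ?AA box f v = \<zero>\<^bsub>?AA\<^esub>"
    using snd by (simp add: prod_eq_iff)
qed

end

theorem proposition3p2:
  fixes R :: "('r, 'm) ring_scheme"
    and A :: "('r, 'a, 'n) module_scheme"
    and Rels :: "(nat \<times> (monomial \<Rightarrow> 'r)) list"
    and \<mu> :: "'a \<Rightarrow> 'a \<Rightarrow> 'a"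
    and P :: "'a \<Rightarrow> 'a"
  assumes "cring R"
    and "\<one>\<^bsub>R\<^esub> \<oplus>\<^bsub>R\<^esub> \<one>\<^bsub>R\<^esub> \<in> Units R"
    and "\<forall>(n, f) \<in> set Rels. multilinear R n f"
    and "in_category R Rels A \<mu>"
    and "rota_baxter_operator R A \<mu> P"
  shows "dendriform_algebra R Rels A (\<lambda>a b. \<mu> a (P b)) (\<lambda>a b. \<mu> (P a) b)"
proof -
  have A: "module R A" "product_on R A \<mu>" "\<And>n f. (n, f) \<in> set Rels \<Longrightarrow> satisfies R A \<mu> n f"
    using assms(4) by (auto simp: in_category_def)
  interpret rota_baxter_algebra R A \<mu> P
    using A assms(5) by (simp add: rota_baxter_algebra_def rota_baxter_algebra_axioms_def)
  have "in_category R Rels (prod_module A A) box"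
    using assms(3) A(3) module_prod_module [OF A(1) A(1)] product_box satisfies_box
    by (auto simp: in_category_def)
  then show ?thesis
    using A(1) product_prec product_succ by (simp add: dendriform_algebra_def box_def)
qed

end
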